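(* Let $\mathcal G$ be Grigorchuk group, acting on the binary rooted tree $\mathcal T$, and let $g\in\mathrm{Aut}(\mathcal T)$ be a binary tree automorphism. The following conditions are equivalent. (i) $g$ belongs to the closure $\bar{\mathcal G}$ of $\mathcal G$ in the pro-finite group $\mathrm{Aut}(\mathcal T)$. (ii) All sections $g_u$ of $g$ ($u$ any vertex of $\mathcal T$, including the root) simulate $\mathcal G$. (iii) The distance from any section $g_u$ of $g$ to $\mathcal G$ in the metric space $\mathrm{Aut}(\mathcal T)$ is at most $\frac1{16}$.
   Context: Tree. Let $X=\{0,1\}$. The vertices of the binary rooted tree $\mathcal T$ are the finite words over $X$; the empty word $\emptyset$ is the root, $X^n$ is level $n$, and each vertex $u$ has two children $u0$ and $u1$. $\mathrm{Aut}(\mathcal T)$ is the group of automorphisms of the rooted tree $\mathcal T$; it acts on the right, so $w^{gh}=(w^g)^h$. It decomposes as $\mathrm{Aut}(\mathcal T)=(\mathrm{Aut}(\mathcal T)\times\mathrm{Aut}(\mathcal T))\rtimes \mathsf S(2)$ with $\mathsf S(2)=\{1,\sigma\}$, $\sigma=(01)$: every $g$ is uniquely written $g=(g_0,g_1)\sigma^{\varepsilon}$, $\varepsilon\in\{0,1\}$, where $g=(g_0,g_1)$ acts by $(0w)^g=0w^{g_0}$, $(1w)^g=1w^{g_1}$, and $g=(g_0,g_1)\sigma$ acts by $(0w)^g=1w^{g_0}$, $(1w)^g=0w^{g_1}$, for all words $w$ over $X$. Sections. $g_0,g_1$ above are the sections of $g$ at $0$ and $1$; the section $g_u$ at any vertex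 $u$ is defined recursively by $g_\emptyset=g$, $g_{ux}=(g_u)_x$ for a word $u$ and a letter $x\in X$. Grigorchuk group. $\mathcal G$ is the subgroup of $\mathrm{Aut}(\mathcal T)$ generated by the automorphisms $a,b,c,d$ defined by $a=(1,1)\sigma$, $b=(a,c)$, $c=(a,d)$, $d=(1,b)$. Portrait decoration. For $g\in\mathrm{Aut}(\mathcal T)$ and a vertex $u$, write $g_u=(g_{u0},g_{u1})\sigma^{\varepsilon}$ with $\varepsilon\in\{0,1\}$ and set $\alpha_u(g)=\varepsilon$ (i.e. $\alpha_u(g)=1$ if $g$ is active at $u$, meaning $g_u$ swaps the two vertices of level 1, and $\alpha_u(g)=0$ otherwise). For every vertex $xy$ on level 2 ($x,y\in X$) define $$\beta_{xy}(g)=\alpha_{xy}(g)+\alpha_{x\bar y0}(g)+\alpha_{x\bar y1}(g) \pmod 2,$$ where $\bar y$ denotes the letter of $\{0,1\}$ different from $y$. Simulation. An automorphism $g\in\mathrm{Aut}(\mathcal T)$ simulates $\mathcal G$ if, writing $\alpha_u=\alpha_u(g)$ and $\beta_{xy}=\beta_{xy}(g)$, all of the following hold (with equalities in $\mathbb Z/2\mathbb Z$): if $\alpha_0=\alpha_1=0$ then $\beta_{00}=\beta_{11}=\beta_{01}=\beta_{10}$; if $\alpha_0=0$ and $\alpha_1=1$ then $\beta_{00}\neq\beta_{11}=\beta_{01}=\beta_{10}$; if $\alpha_0=1$ and $\alpha_1=0$ then $\beta_{00}=\beta_{11}=\beta_{01}\neq\beta_{10}$; if $\alpha_0=\alpha_1=1$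 then $\beta_{00}=\beta_{11}\neq\beta_{01}=\beta_{10}$. Metric. $\mathrm{Aut}(\mathcal T)$ carries its pro-finite topology, induced by the following metric: for $g\ne h$ the distance between $g$ and $h$ is $\frac1{2^n}$, where $n$ is the largest integer for which $g$ and $h$ agree on all words of length $n$; the distance from $g$ to itself is $0$. The distance from an automorphism to $\mathcal G$ is the infimum of its distances to elements of $\mathcal G$. *)

theory Defs
  imports
    "HOL-Algebra.Generated_Groups"
    "HOL-Analysis.Abstract_Metric_Spaces"
    "HOL-Library.Z2"
begin

section \<open>The binary rooted tree and its automorphisms\<close>

text \<open>The alphabet is the type \<^typ>\<open>bit\<close>, i.e. Z/2Z, so that the letter different from \<open>y\<close> is \<open>y + 1\<close>
  and sums of decorations are automatically taken mod 2.\<close>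

type_synonym word = "bit list"

definition child :: "word \<Rightarrow> word \<Rightarrow> bool" where
  "child u v \<longleftrightarrow> (\<exists>x. v = u @ [x])"

definition tree_aut :: "(word \<Rightarrow> word) \<Rightarrow> bool" where
  "tree_aut g \<longleftrightarrow> bij g \<and> g [] = [] \<and> (\<forall>u v. child (g u) (g v) \<longleftrightarrow> child u v)"

text \<open>An automorphism of the rooted tree is a bijection on vertices that fixes the root and preserves the
  edges (the library notation for function inverse is shadowed by group inverse, hence \<open>inv_into UNIV\<close>
  below). Automorphisms act on the right, so the product of \<open>g\<close> and \<open>h\<close> is "first \<open>g\<close>, then \<open>h\<close>".\<close>

definition AutT :: "(word \<Rightarrow> word) monoid" where
  "AutT = \<lparr>carrier = {g. tree_aut g}, mult = (\<lambda>g h. h \<circ> g), one = id\<rparr>"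

text \<open>\<open>wreath g0 g1 e\<close> is the automorphism \<open>(g0, g1) \<sigma>\<^sup>e\<close>.\<close>

primrec wreath :: "(word \<Rightarrow> word) \<Rightarrow> (word \<Rightarrow> word) \<Rightarrow> bit \<Rightarrow> word \<Rightarrow> word" where
  "wreath g0 g1 e [] = []"
| "wreath g0 g1 e (x # w) = (x + e) # (if x = 0 then g0 w else g1 w)"

definition letter_section :: "(word \<Rightarrow> word) \<Rightarrow> bit \<Rightarrow> word \<Rightarrow> word" where
  "letter_section g x = (\<lambda>w. tl (g (x # w)))"

definition sect :: "(word \<Rightarrow> word) \<Rightarrow> word \<Rightarrow> word \<Rightarrow> word" where
  "sect g u = foldl letter_section g u"

text \<open>\<open>activity g u\<close> is the decoration \<open>\<alpha>\<^sub>u(g)\<close>, and \<open>beta g x y\<close> is \<open>\<beta>\<^bsub>xy\<^esub>(g)\<close>.\<close>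

definition activity :: "(word \<Rightarrow> word) \<Rightarrow> word \<Rightarrow> bit" where
  "activity g u = (if sect g u [0] = [1] then 1 else 0)"

definition beta :: "(word \<Rightarrow> word) \<Rightarrow> bit \<Rightarrow> bit \<Rightarrow> bit" where
  "beta g x y = activity g [x, y] + activity g [x, y + 1, 0] + activity g [x, y + 1, 1]"


section \<open>The Grigorchuk group\<close>

definition grig_a :: "word \<Rightarrow> word" where
  "grig_a = wreath id id 1"

fun grig_b :: "word \<Rightarrow> word" and grig_c :: "word \<Rightarrow> word" and grig_d :: "word \<Rightarrow> word" where
  "grig_b [] = []"
| "grig_b (x # w) = x # (if x = 0 then grig_a w else grig_c w)"
| "grig_c [] = []"
| "grig_c (x # w) = x # (if x = 0 then grig_a w else grig_d w)"
| "grig_d [] = []"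
| "grig_d (x # w) = x # (if x = 0 then w else grig_b w)"

definition Grigorchuk :: "(word \<Rightarrow> word) set" where
  "Grigorchuk = generate AutT {grig_a, grig_b, grig_c, grig_d}"

definition simulates_Grigorchuk :: "(word \<Rightarrow> word) \<Rightarrow> bool" where
  "simulates_Grigorchuk g \<longleftrightarrow>
     (activity g [0] = 0 \<and> activity g [1] = 0 \<longrightarrow>
        beta g 0 0 = beta g 1 1 \<and> beta g 1 1 = beta g 0 1 \<and> beta g 0 1 = beta g 1 0) \<and>
     (activity g [0] = 0 \<and> activity g [1] = 1 \<longrightarrow>
        beta g 0 0 \<noteq> beta g 1 1 \<and> beta g 1 1 = beta g 0 1 \<and> beta g 0 1 = beta g 1 0) \<and>
     (activity g [0] = 1 \<and> activity g [1] = 0 \<longrightarrow>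
        beta g 0 0 = beta g 1 1 \<and> beta g 1 1 = beta g 0 1 \<and> beta g 0 1 \<noteq> beta g 1 0) \<and>
     (activity g [0] = 1 \<and> activity g [1] = 1 \<longrightarrow>
        beta g 0 0 = beta g 1 1 \<and> beta g 1 1 \<noteq> beta g 0 1 \<and> beta g 0 1 = beta g 1 0)"


section \<open>The metric on Aut(T)\<close>

definition agree_on_level :: "(word \<Rightarrow> word) \<Rightarrow> (word \<Rightarrow> word) \<Rightarrow> nat \<Rightarrow> bool" where
  "agree_on_level g h n \<longleftrightarrow> (\<forall>w. length w = n \<longrightarrow> g w = h w)"

definition aut_dist :: "(word \<Rightarrow> word) \<Rightarrow> (word \<Rightarrow> word) \<Rightarrow> real" where
  "aut_dist g h = (if g = h then 0 else 1 / 2 ^ (GREATEST n. agree_on_level g h n))"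

definition dist_to_Grigorchuk :: "(word \<Rightarrow> word) \<Rightarrow> real" where
  "dist_to_Grigorchuk g = (INF h\<in>Grigorchuk. aut_dist g h)"

definition AutT_topology :: "(word \<Rightarrow> word) topology" where
  "AutT_topology = Metric_space.mtopology (carrier AutT) aut_dist"


section \<open>Basic facts about the definitions\<close>

lemma tree_aut_snoc:
  assumes "tree_aut g" shows "\<exists>y. g (u @ [x]) = g u @ [y]"
  using assms by (auto simp: tree_aut_def child_def)

lemma tree_aut_length: "tree_aut g \<Longrightarrow> length (g u) = length u"
proof (induction u rule: rev_induct)
  case Nil then show ?case by (simp add: tree_aut_def)
next
  case (snoc x u) then show ?case using tree_aut_snoc[of g u x] by auto
qed

lemma tree_aut_append:
  assumes "tree_aut g" shows "\<exists>w. g (u @ v) = g u @ w \<and> length w = length v"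
proof (induction v rule: rev_induct)
  case Nil then show ?case by simp
next
  case (snoc x v)
  then obtain w where w: "g (u @ v) = g u @ w" "length w = length v" by auto
  obtain y where "g ((u @ v) @ [x]) = g (u @ v) @ [y]" using tree_aut_snoc[OF assms] by blast
  then show ?case using w by (intro exI[of _ "w @ [y]"]) simp
qed

lemma tree_aut_id: "tree_aut id"
  by (simp add: tree_aut_def)

lemma tree_aut_comp: "tree_aut g \<Longrightarrow> tree_aut h \<Longrightarrow> tree_aut (h \<circ> g)"
  by (auto simp: tree_aut_def intro: bij_comp)

lemma tree_aut_inv:
  assumes "tree_aut g" shows "tree_aut (inv_into UNIV g)"
proof -
  have b: "bij g" using assms by (simp add: tree_aut_def)
  then have s: "g (inv_into UNIV g u) = u" for u by (simp add: bij_is_surj surj_f_inv_f)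
  have "inv_into UNIV g [] = []" using assms b by (metis tree_aut_def bij_inv_eq_iff)
  moreover have "child (inv_into UNIV g u) (inv_into UNIV g v) \<longleftrightarrow> child u v" for u v
    using assms s unfolding tree_aut_def by metis
  ultimately show ?thesis using b by (simp add: tree_aut_def bij_imp_bij_inv)
qed

lemma group_AutT: "group AutT"
proof (rule groupI)
  show "\<exists>y\<in>carrier AutT. y \<otimes>\<^bsub>AutT\<^esub> x = \<one>\<^bsub>AutT\<^esub>" if "x \<in> carrier AutT" for x
  proof (rule bexI[of _ "inv_into UNIV x"])
    show "inv_into UNIV x \<in> carrier AutT" using that tree_aut_inv by (simp add: AutT_def)
    show "inv_into UNIV x \<otimes>\<^bsub>AutT\<^esub> x = \<one>\<^bsub>AutT\<^esub>"
      using that by (auto simp: AutT_def tree_aut_def fun_eq_iff bij_is_surj surj_f_inv_f)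
  qed
qed (auto simp: AutT_def tree_aut_id intro: tree_aut_comp simp: o_assoc simp del: o_apply)

lemma tree_aut_wreath:
  assumes "tree_aut g0" "tree_aut g1" shows "tree_aut (wreath g0 g1 e)"
proof -
  let ?f = "wreath g0 g1 e"
  have b: "bij g0" "bij g1" using assms by (auto simp: tree_aut_def)
  have e2: "z + e + e = z" for z :: bit by (cases z; cases e) simp_all
  have inj: "inj ?f"
  proof (rule injI)
    fix u v assume uv: "?f u = ?f v"
    show "u = v"
    proof (cases u; cases v)
      fix x w y z assume "u = x # w" "v = y # z"
      moreover from this have "x + e + e = y + e + e" using uv by (simp only: wreath.simps list.inject)
      then have "x = y" by (simp only: e2)
      ultimately show ?thesis using uv b by (simp add: bij_is_inj inj_eq split: if_splits)
    qed (use uv in auto)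
  qed
  have surj: "\<exists>u. ?f u = v" for v
  proof (cases v)
    case Nil then show ?thesis by (intro exI[of _ "[]"]) simp
  next
    case (Cons x w)
    define y where "y = x + e"
    then have y: "y + e = x" by (simp only: e2)
    have "?f (y # (if y = 0 then inv_into UNIV g0 w else inv_into UNIV g1 w)) = v"
      unfolding wreath.simps Cons y using b by (simp add: bij_is_surj surj_f_inv_f)
    then show ?thesis by blast
  qed
  have fwd: "\<exists>y. ?f (u @ [x]) = ?f u @ [y]" for u x
  proof (cases u)
    case Nil then show ?thesis using assms by (simp add: tree_aut_def)
  next
    case (Cons z w)
    then show ?thesis using tree_aut_snoc[OF assms(1), of w x] tree_aut_snoc[OF assms(2), of w x] by auto
  qed
  have "child u v" if c: "child (?f u) (?f v)" for u v
  proof -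
    have len: "length (?f w) = length w" for w
      using assms by (cases w) (auto simp: tree_aut_length)
    have "length v = Suc (length u)" using c len by (metis child_def length_append_singleton)
    then obtain u' x where v: "v = u' @ [x]" by (metis append_butlast_last_id list.size(3) nat.distinct(1))
    then obtain y where "?f v = ?f u' @ [y]" using fwd by blast
    then have "?f u' = ?f u" using c by (auto simp: child_def)
    then show ?thesis using inj v by (auto simp: child_def dest: injD)
  qed
  then show ?thesis using inj surj fwd
    unfolding tree_aut_def child_def bij_def surj_def by (metis wreath.simps(1))
qed

lemma grig_wreath:
  "grig_b = wreath grig_a grig_c 0" "grig_c = wreath grig_a grig_d 0" "grig_d = wreath id grig_b 0"
proof -
  show "grig_b = wreath grig_a grig_c 0"
  proof fix w show "grig_b w = wreath grig_a grig_c 0 w" by (cases w) simp_all qed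
  show "grig_c = wreath grig_a grig_d 0"
  proof fix w show "grig_c w = wreath grig_a grig_d 0 w" by (cases w) simp_all qed
  show "grig_d = wreath id grig_b 0"
  proof fix w show "grig_d w = wreath id grig_b 0 w" by (cases w) simp_all qed
qed

lemma tree_aut_cong_level:
  assumes "\<And>n. \<exists>h. tree_aut h \<and> (\<forall>w. length w \<le> n \<longrightarrow> g w = h w)"
  shows "tree_aut g"
proof -
  have len: "length (g w) = length w" for w
    using assms[of "length w"] tree_aut_length by auto
  have "u = v" if uv: "g u = g v" for u v
  proof -
    obtain h where h: "tree_aut h" "\<forall>w. length w \<le> max (length u) (length v) \<longrightarrow> g w = h w"
      using assms by blast
    then have "h u = h v" using uv by simp
    then show ?thesis using h(1) by (auto simp: tree_aut_def dest: bij_is_inj injD)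
  qed
  moreover have "\<exists>u. g u = v" for v
  proof -
    obtain h where h: "tree_aut h" "\<forall>w. length w \<le> length v \<longrightarrow> g w = h w"
      using assms by blast
    then obtain u where u: "h u = v" by (metis tree_aut_def bij_pointE)
    then have "length u = length v" using tree_aut_length[OF h(1)] by auto
    then show ?thesis using h(2) u by (metis le_refl)
  qed
  moreover have "g [] = []" using len[of "[]"] by simp
  moreover have "child (g u) (g v) \<longleftrightarrow> child u v" for u v
  proof -
    obtain h where h: "tree_aut h" "\<forall>w. length w \<le> max (length u) (length v) \<longrightarrow> g w = h w"
      using assms by blast
    then show ?thesis by (simp add: tree_aut_def)
  qed
  ultimately show ?thesis by (auto simp: tree_aut_def bij_def inj_def surj_def) metis+
qed

lemma tree_aut_grig: "tree_aut grig_a" "tree_aut grig_b" "tree_aut grig_c" "tree_aut grig_d"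
proof -
  show a: "tree_aut grig_a" unfolding grig_a_def by (intro tree_aut_wreath tree_aut_id)
  have *: "(\<exists>h. tree_aut h \<and> (\<forall>w. length w \<le> n \<longrightarrow> grig_b w = h w)) \<and>
           (\<exists>h. tree_aut h \<and> (\<forall>w. length w \<le> n \<longrightarrow> grig_c w = h w)) \<and>
           (\<exists>h. tree_aut h \<and> (\<forall>w. length w \<le> n \<longrightarrow> grig_d w = h w))" for n
  proof (induction n)
    case 0 then show ?case by (auto intro: exI[of _ id] simp: tree_aut_id)
  next
    case (Suc n)
    have step: "\<exists>h. tree_aut h \<and> (\<forall>w. length w \<le> Suc n \<longrightarrow> wreath k g 0 w = h w)"
      if k: "tree_aut k" and g: "\<exists>h. tree_aut h \<and> (\<forall>w. length w \<le> n \<longrightarrow> g w = h w)" for k g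
    proof -
      obtain h where h: "tree_aut h" "\<forall>w. length w \<le> n \<longrightarrow> g w = h w" using g by blast
      have "wreath k g 0 w = wreath k h 0 w" if "length w \<le> Suc n" for w
        using that h by (cases w) auto
      then show ?thesis using tree_aut_wreath[OF k h(1)] by blast
    qed
    show ?case
      using Suc step[OF a, of grig_c] step[OF a, of grig_d] step[OF tree_aut_id, of grig_b]
      by (simp only: grig_wreath[symmetric] simp_thms)
  qed
  show "tree_aut grig_b" "tree_aut grig_c" "tree_aut grig_d"
    by (rule tree_aut_cong_level; use * in blast)+
qed

lemma subgroup_Grigorchuk: "subgroup Grigorchuk AutT"
  unfolding Grigorchuk_def
  by (rule group.generate_is_subgroup[OF group_AutT]) (simp add: AutT_def tree_aut_grig)

lemma sect_simps: "sect g [] = g" "sect g (u @ [x]) = letter_section (sect g u) x"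
  by (simp_all add: sect_def)

lemma tree_aut_Cons:
  assumes "tree_aut g"
  shows "g (x # w) = (x + activity g []) # letter_section g x w"
proof -
  obtain y where y: "g ([] @ [x]) = g [] @ [y]" using tree_aut_snoc[OF assms] by blast
  obtain y0 where y0: "g ([] @ [0]) = g [] @ [y0]" using tree_aut_snoc[OF assms] by blast
  have nil: "g [] = []" and inj: "inj g" using assms by (auto simp: tree_aut_def bij_is_inj)
  have "y = x + activity g []"
  proof (cases x)
    assume "x = 0"
    with y y0 nil show ?thesis by (cases y0) (auto simp: activity_def sect_simps)
  next
    assume 1: "x = 1"
    then have "y \<noteq> y0" using y y0 nil injD[OF inj, of "[0]" "[1]"] by auto
    then show ?thesis using y y0 nil 1 by (cases y0; cases y) (auto simp: activity_def sect_simps)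
  qed
  moreover obtain v where "g ([x] @ w) = g [x] @ v" using tree_aut_append[OF assms] by blast
  ultimately show ?thesis using y nil by (simp add: letter_section_def)
qed

lemma tree_aut_eq_wreath:
  assumes "tree_aut g"
  shows "g = wreath (letter_section g 0) (letter_section g 1) (activity g [])"
proof
  fix w
  show "g w = wreath (letter_section g 0) (letter_section g 1) (activity g []) w"
  proof (cases w)
    case Nil then show ?thesis using assms by (simp add: tree_aut_def)
  next
    case (Cons x v)
    then show ?thesis by (cases x) (simp_all add: tree_aut_Cons[OF assms])
  qed
qed

lemma tree_aut_letter_section:
  assumes "tree_aut g" shows "tree_aut (letter_section g x)"
proof -
  let ?s = "letter_section g x" and ?e = "activity g []"
  have c: "g (y # w) = (y + ?e) # letter_section g y w" for y w by (rule tree_aut_Cons[OF assms])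
  have b: "bij g" using assms by (simp add: tree_aut_def)
  have "inj ?s" using c[of x] bij_is_inj[OF b] by (intro injI) (metis injD list.inject)
  moreover have "\<exists>u. ?s u = v" for v
  proof -
    obtain w where w: "g w = (x + ?e) # v" using b by (metis bij_pointE)
    then obtain y u where yu: "w = y # u" using assms by (cases w) (auto simp: tree_aut_def)
    then have "y + ?e = x + ?e" "letter_section g y u = v" using w c by auto
    moreover from this have "y = x" by (simp only: add_right_cancel)
    ultimately show ?thesis by blast
  qed
  moreover have "?s [] = []" 
  proof -
    have "length (?s []) = 0" using tree_aut_length[OF assms, of "[x]"] unfolding c by simp
    then show ?thesis by simp
  qed
  moreover have "child (?s u) (?s v) \<longleftrightarrow> child u v" for u v
  proof -
    have *: "child (z # p) (z # q) \<longleftrightarrow> child p q" for z p q by (simp add: child_def)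
    have "child (g (x # u)) (g (x # v)) \<longleftrightarrow> child (x # u) (x # v)" using assms by (simp add: tree_aut_def)
    then show ?thesis unfolding c * .
  qed
  ultimately show ?thesis unfolding tree_aut_def bij_def surj_def by metis
qed

lemma tree_aut_sect: "tree_aut g \<Longrightarrow> tree_aut (sect g u)"
  by (induction u rule: rev_induct) (simp_all add: sect_simps tree_aut_letter_section)

lemma agree_on_level_mono:
  assumes "tree_aut g" "tree_aut h" "agree_on_level g h n" "m \<le> n"
  shows "agree_on_level g h m"
  unfolding agree_on_level_def
proof (intro allI impI)
  fix w :: word assume w: "length w = m"
  let ?z = "replicate (n - m) 0"
  have "g (w @ ?z) = h (w @ ?z)" using assms w by (simp add: agree_on_level_def)
  moreover obtain p where "g (w @ ?z) = g w @ p" using tree_aut_append[OF assms(1)] by blast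
  moreover obtain q where "h (w @ ?z) = h w @ q" using tree_aut_append[OF assms(2)] by blast
  ultimately show "g w = h w"
    using tree_aut_length[OF assms(1), of w] tree_aut_length[OF assms(2), of w] by simp
qed

lemma agree_on_level_Greatest:
  assumes "tree_aut g" "tree_aut h" "g \<noteq> h"
  shows "agree_on_level g h n \<longleftrightarrow> n \<le> (GREATEST n. agree_on_level g h n)"
proof -
  obtain w where w: "g w \<noteq> h w" using assms(3) by auto
  have bd: "m \<le> length w" if "agree_on_level g h m" for m
  proof (rule ccontr)
    assume "\<not> m \<le> length w"
    then have "agree_on_level g h (length w)" using agree_on_level_mono[OF assms(1,2) that] by simp
    then show False using w by (simp add: agree_on_level_def)
  qed
  have "agree_on_level g h 0" using assms by (simp add: agree_on_level_def tree_aut_def)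
  then have "agree_on_level g h (GREATEST n. agree_on_level g h n)"
    using bd by (rule GreatestI_nat)
  moreover have "n \<le> (GREATEST n. agree_on_level g h n)" if "agree_on_level g h n"
    using that bd by (rule Greatest_le_nat)
  ultimately show ?thesis using agree_on_level_mono[OF assms(1,2)] by blast
qed

lemma Metric_space_AutT: "Metric_space (carrier AutT) aut_dist"
proof
  show "0 \<le> aut_dist g h" for g h by (simp add: aut_dist_def)
  show "aut_dist g h = aut_dist h g" for g h
  proof -
    have "agree_on_level g h = agree_on_level h g" by (auto simp: agree_on_level_def fun_eq_iff)
    then show ?thesis by (auto simp: aut_dist_def)
  qed
  show "aut_dist g h = 0 \<longleftrightarrow> g = h" for g h by (simp add: aut_dist_def)
  show "aut_dist g k \<le> aut_dist g h + aut_dist h k"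
    if "g \<in> carrier AutT" "h \<in> carrier AutT" "k \<in> carrier AutT" for g h k
  proof (cases "g = k \<or> g = h \<or> h = k")
    case True then show ?thesis by (auto simp: aut_dist_def)
  next
    case False
    have t: "tree_aut g" "tree_aut h" "tree_aut k" using that by (auto simp: AutT_def)
    let ?G = "\<lambda>f f'. GREATEST n. agree_on_level f f' n"
    define m where "m = min (?G g h) (?G h k)"
    have "agree_on_level g h m" "agree_on_level h k m"
      using False t agree_on_level_Greatest[of g h m] agree_on_level_Greatest[of h k m]
      by (auto simp: m_def)
    then have "agree_on_level g k m" by (auto simp: agree_on_level_def)
    then have le: "m \<le> ?G g k" using False t agree_on_level_Greatest[of g k m] by blast
    have "1 / 2 ^ ?G g k \<le> (1 / 2 ^ m :: real)"
      by (intro divide_left_mono power_increasing le) auto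
    also have "\<dots> \<le> 1 / 2 ^ ?G g h + 1 / 2 ^ ?G h k"
      unfolding m_def min_def by (cases "?G g h \<le> ?G h k") simp_all
    finally show ?thesis using False by (simp add: aut_dist_def)
  qed
qed

end

theory Submission
  imports Defs
begin

text \<open>The decoration is a cocycle:
  \<open>\<beta>\<^bsub>xy\<^esub>(gh) = \<beta>\<^bsub>xy\<^esub>(g) + \<beta>\<close> of \<open>h\<close> at the image of \<open>xy\<close>. Hence the automorphisms that simulate the
  Grigorchuk group are closed under products, and they contain the generators, whose sections are
  again generators or trivial.

  Conversely, let all sections of \<open>g\<close> simulate. Multiplying by elements of the group makes \<open>g\<close> trivial on
  level 3. The group contains a subgroup \<open>K\<close>, the normal closure of \<open>(ab)\<^sup>2\<close>, with \<open>K \<times> K \<subseteq> K\<close>, and every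
  simulating automorphism that is trivial on level 3 agrees with an element of \<open>K\<close> on level 4. By
  \<open>K \<times> K \<subseteq> K\<close>, if \<open>g\<close> is trivial on level \<open>n \<ge> 3\<close>, then it agrees with an element of \<open>K\<close> on level
  \<open>n + 1\<close>; so \<open>g\<close> is approximated by the group one level at a time.\<close>

section \<open>Activities and sections\<close>

text \<open>Sums and products of decorations stay ring operations, so that the rules for commutative
  rings apply to them.\<close>

declare add_bit_eq_xor [simp del] mult_bit_eq_and [simp del]

lemma bit_add_self [simp]: "(x :: bit) + x = 0" "x + (x + y) = y"
  by (cases x; cases y; simp add: add_bit_eq_xor)+

lemma sect_Cons: "sect g (x # u) = sect (letter_section g x) u"
  by (simp add: sect_def)

lemma sect_append: "sect g (u @ v) = sect (sect g u) v"
  by (simp add: sect_def)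

lemma activity_sect: "activity (sect g u) v = activity g (u @ v)"
  by (simp add: activity_def sect_append)

lemma tree_aut_append_sect:
  assumes "tree_aut g"
  shows "g (u @ v) = g u @ sect g u v"
proof (induction u arbitrary: v rule: rev_induct)
  case Nil
  then show ?case using assms by (simp add: sect_simps tree_aut_def)
next
  case (snoc x u)
  let ?s = "sect g u"
  have s: "tree_aut ?s" using assms by (rule tree_aut_sect)
  have "letter_section ?s x [] = []"
    using tree_aut_letter_section[OF s] by (simp add: tree_aut_def)
  then show ?case
    using snoc[of "[x]"] snoc[of "x # v"] tree_aut_Cons[OF s, of x]
    by (simp add: sect_simps)
qed

lemma tree_aut_snoc_activity:
  assumes "tree_aut g"
  shows "g (u @ [x]) = g u @ [x + activity g u]"
proof -
  have s: "tree_aut (sect g u)" using assms by (rule tree_aut_sect)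
  have "letter_section (sect g u) x [] = []"
    using tree_aut_letter_section[OF s] by (simp add: tree_aut_def)
  then show ?thesis
    using tree_aut_append_sect[OF assms, of u "[x]"] tree_aut_Cons[OF s, of x "[]"]
      activity_sect[of g u "[]"] by simp
qed

text \<open>Reduces an activity to the image of one word, which the simplifier can evaluate for a
  concrete composition of generators.\<close>

lemma activity_last: "tree_aut g \<Longrightarrow> activity g u = last (g (u @ [0]))"
  by (simp add: tree_aut_snoc_activity)

lemma sect_comp:
  assumes "tree_aut g" "tree_aut h"
  shows "sect (h \<circ> g) u = sect h (g u) \<circ> sect g u"
proof
  fix v
  have "(h \<circ> g) (u @ v) = h (g u) @ sect h (g u) (sect g u v)"
    by (simp add: tree_aut_append_sect[OF assms(1)] tree_aut_append_sect[OF assms(2)])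
  then show "sect (h \<circ> g) u v = (sect h (g u) \<circ> sect g u) v"
    using tree_aut_append_sect[OF tree_aut_comp[OF assms], of u v] by simp
qed

lemma activity_comp:
  assumes "tree_aut g" "tree_aut h"
  shows "activity (h \<circ> g) u = activity g u + activity h (g u)"
proof -
  have "(h \<circ> g) (u @ [0]) = h (g u) @ [activity g u + activity h (g u)]"
    by (simp add: tree_aut_snoc_activity[OF assms(1)] tree_aut_snoc_activity[OF assms(2)])
  then show ?thesis
    using tree_aut_snoc_activity[OF tree_aut_comp[OF assms], of u 0] by simp
qed

text \<open>The image of a child is the image of its parent followed by a letter that the activity
  at the parent decides. Hence one more level of agreement amounts to equal activities at the
  vertices of length \<open>n\<close>.\<close>

lemma agree_on_level_iff_activity:
  assumes "tree_aut g" "tree_aut h"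
  shows "agree_on_level g h n \<longleftrightarrow> (\<forall>u. length u < n \<longrightarrow> activity g u = activity h u)"
proof (induction n)
  case 0
  then show ?case using assms by (simp add: agree_on_level_def tree_aut_def)
next
  case (Suc n)
  have "agree_on_level g h (Suc n) \<longleftrightarrow>
      agree_on_level g h n \<and> (\<forall>u. length u = n \<longrightarrow> activity g u = activity h u)"
  proof (intro iffI conjI allI impI)
    assume a: "agree_on_level g h (Suc n)"
    show "agree_on_level g h n" by (rule agree_on_level_mono[OF assms a]) simp
    show "activity g u = activity h u" if "length u = n" for u
    proof -
      have "g (u @ [0]) = h (u @ [0])" using a that by (simp add: agree_on_level_def)
      then show ?thesis
        by (simp add: tree_aut_snoc_activity[OF assms(1)] tree_aut_snoc_activity[OF assms(2)])
    qed
  next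
    assume a: "agree_on_level g h n \<and> (\<forall>u. length u = n \<longrightarrow> activity g u = activity h u)"
    show "agree_on_level g h (Suc n)" unfolding agree_on_level_def
    proof (intro allI impI)
      fix w :: word assume "length w = Suc n"
      then obtain u x where w: "w = u @ [x]" "length u = n"
        by (metis length_Suc_conv_rev)
      then have "g u = h u" "activity g u = activity h u" using a by (simp_all add: agree_on_level_def)
      then show "g w = h w"
        by (simp add: w tree_aut_snoc_activity[OF assms(1)] tree_aut_snoc_activity[OF assms(2)])
    qed
  qed
  then show ?case unfolding Suc less_Suc_eq by blast
qed

lemma activity_id [simp]: "activity id u = 0"
proof -
  have "id (u @ [0]) = id u @ [0 + activity id u]" by (rule tree_aut_snoc_activity[OF tree_aut_id])
  then show ?thesis by simp
qed

lemma activity_wreath: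
  "tree_aut g0 \<Longrightarrow> activity (wreath g0 g1 e) [] = e"
  "activity (wreath g0 g1 e) (x # u) = activity (if x = 0 then g0 else g1) u"
proof -
  show "activity (wreath g0 g1 e) [] = e" if "tree_aut g0"
    using that by (cases e) (simp_all add: activity_def sect_simps tree_aut_def)
  have "letter_section (wreath g0 g1 e) x = (if x = 0 then g0 else g1)"
    by (auto simp: letter_section_def)
  then show "activity (wreath g0 g1 e) (x # u) = activity (if x = 0 then g0 else g1) u"
    by (simp add: activity_def sect_Cons)
qed

lemma agree_on_level_sect:
  assumes "tree_aut g" "tree_aut h" "agree_on_level g h (length u + n)"
  shows "agree_on_level (sect g u) (sect h u) n"
  using assms(3) by (simp add: agree_on_level_iff_activity assms(1,2) tree_aut_sect activity_sect)

lemma agree_on_level_comp_left: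
  "agree_on_level g h n \<Longrightarrow> agree_on_level (k \<circ> g) (k \<circ> h) n"
  by (simp add: agree_on_level_def)


section \<open>Automorphisms all of whose sections simulate\<close>

text \<open>The activities at the two children of \<open>[x, y + 1]\<close> enter \<^const>\<open>beta\<close> symmetrically, so the action of \<open>g\<close> on
  the third level does not matter.\<close>

lemma beta_comp:
  assumes "tree_aut g" "tree_aut h"
  shows "beta (h \<circ> g) x y
       = beta g x y + beta h (x + activity g []) (y + activity g [x])"
proof -
  have nil: "g [] = []" using assms(1) by (simp add: tree_aut_def)
  have g1: "g [x] = [x + activity g []]" for x
    using tree_aut_snoc_activity[OF assms(1), of "[]" x] nil by simp
  have g2: "g [x, y] = [x + activity g [], y + activity g [x]]" for x y
    using tree_aut_snoc_activity[OF assms(1), of "[x]" y] g1 by simp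
  have g3: "g [x, y, z] = [x + activity g [], y + activity g [x], z + activity g [x, y]]" for x y z
    using tree_aut_snoc_activity[OF assms(1), of "[x, y]" z] g2 by simp
  define p where "p = x + activity g []"
  define q where "q = y + activity g [x]"
  have q1: "y + 1 + activity g [x] = q + 1" by (simp only: q_def ac_simps)
  define r where "r = activity g [x, y + 1]"
  have "activity h [p, q + 1, 0 + r] + activity h [p, q + 1, 1 + r]
      = activity h [p, q + 1, 0] + activity h [p, q + 1, 1]"
    by (cases r) (simp_all only: bit_add_self add_0_left add_0_right add.commute)
  moreover have "u + m + (v + a) + (w + b) = u + v + w + (m + c + d)"
    if "a + b = c + d" for u v w m a b c d :: bit
  proof -
    have "u + m + (v + a) + (w + b) = u + v + w + m + (a + b)" by (simp only: ac_simps)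
    then show ?thesis unfolding that by (simp only: ac_simps)
  qed
  ultimately show ?thesis
    unfolding beta_def activity_comp[OF assms] g2 g3 q1 p_def[symmetric] q_def[symmetric] r_def[symmetric]
    by blast
qed

text \<open>The four cases become polynomial equations over Z/2: \<open>p * (q + 1)\<close> and
  \<open>p * q\<close> are the indicators of the cases (1,0) and (1,1).\<close>

lemma simulates_iff:
  "simulates_Grigorchuk g \<longleftrightarrow>
     beta g 0 0 = beta g 0 1 + activity g [1] \<and>
     beta g 1 0 = beta g 0 1 + activity g [0] * (activity g [1] + 1) \<and>
     beta g 1 1 = beta g 0 1 + activity g [0] * activity g [1]"
proof -
  obtain b00 b01 b10 b11 where b: "beta g 0 0 = b00" "beta g 0 1 = b01" "beta g 1 0 = b10" "beta g 1 1 = b11"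
    by blast
  show ?thesis
    unfolding simulates_Grigorchuk_def b
    by (cases "activity g [0]"; cases "activity g [1]"; cases b00; cases b01; cases b10; cases b11) simp_all
qed

text \<open>By \<open>beta_comp\<close>, \<open>g\<close> permutes the decorations of
  \<open>h\<close> through its activities at the root and on level 1 only. Together with the
  activities of \<open>h\<close> on level 1 these leave finitely many cases, and in each one the
  equations for the product follow from those for the factors.\<close>

lemma simulates_comp:
  assumes "tree_aut g" "tree_aut h" "simulates_Grigorchuk g" "simulates_Grigorchuk h"
  shows "simulates_Grigorchuk (h \<circ> g)"
proof -
  have nil: "g [] = []" using assms(1) by (simp add: tree_aut_def)
  have g1: "g [x] = [x + activity g []]" for x
    using tree_aut_snoc_activity[OF assms(1), of "[]" x] nil by simp
  obtain e p q where e: "activity g [] = e" "activity g [0] = p" "activity g [1] = q" by blast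
  obtain p' q' where e': "activity h [0] = p'" "activity h [1] = q'" by blast
  show ?thesis
    using assms(3,4)
    unfolding simulates_iff beta_comp[OF assms(1,2)] activity_comp[OF assms(1,2)] g1 e
    by (cases e; cases p; cases q; cases p'; cases q') (simp_all add: e' ac_simps)
qed

section \<open>The generators and their sections\<close>

lemma activity_grig_a: "activity grig_a u = (if u = [] then 1 else 0)"
  by (cases u) (simp_all add: grig_a_def activity_wreath tree_aut_id)

lemma activity_grig:
  "activity grig_b [] = 0" "activity grig_c [] = 0" "activity grig_d [] = 0"
  "activity grig_b (x # u) = activity (if x = 0 then grig_a else grig_c) u"
  "activity grig_c (x # u) = activity (if x = 0 then grig_a else grig_d) u"
  "activity grig_d (x # u) = activity (if x = 0 then id else grig_b) u"
  by (subst grig_wreath, simp add: activity_wreath tree_aut_grig tree_aut_id)+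

lemma simulates_id: "simulates_Grigorchuk id"
  by (simp add: simulates_Grigorchuk_def beta_def)

lemma simulates_grig:
  "simulates_Grigorchuk grig_a" "simulates_Grigorchuk grig_b"
  "simulates_Grigorchuk grig_c" "simulates_Grigorchuk grig_d"
  by (simp_all add: simulates_Grigorchuk_def beta_def activity_grig activity_grig_a)

definition sections_simulate :: "(word \<Rightarrow> word) \<Rightarrow> bool" where
  "sections_simulate g \<longleftrightarrow> tree_aut g \<and> (\<forall>u. simulates_Grigorchuk (sect g u))"

lemma sections_simulate_comp:
  assumes "sections_simulate g" "sections_simulate h"
  shows "sections_simulate (h \<circ> g)"
  using assms unfolding sections_simulate_def
  by (auto simp: sect_comp intro!: simulates_comp tree_aut_sect tree_aut_comp simp del: o_apply)

lemma sections_simulate_sect: "sections_simulate g \<Longrightarrow> sections_simulate (sect g u)"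
  by (simp add: sections_simulate_def tree_aut_sect flip: sect_append)

lemma sections_simulate_letter_section:
  "sections_simulate g \<Longrightarrow> sections_simulate (letter_section g x)"
  using sections_simulate_sect[of g "[x]"] by (simp add: sect_def)

lemma sect_grig:
  "s \<in> {id, grig_a, grig_b, grig_c, grig_d} \<Longrightarrow> sect s u \<in> {id, grig_a, grig_b, grig_c, grig_d}"
proof (induction u arbitrary: s)
  case (Cons x u)
  have w: "letter_section (wreath g0 g1 e) x = (if x = 0 then g0 else g1)" for g0 g1 e
    by (auto simp: letter_section_def)
  have "letter_section s x \<in> {id, grig_a, grig_b, grig_c, grig_d}"
    using Cons.prems w[of id id 1] w[of grig_a grig_c 0] w[of grig_a grig_d 0] w[of id grig_b 0]
    unfolding grig_wreath[symmetric] grig_a_def[symmetric]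
    by (auto simp: letter_section_def)
  then show ?case unfolding sect_Cons by (rule Cons.IH)
qed (simp add: sect_simps)

lemma sections_simulate_grig:
  assumes "s \<in> {id, grig_a, grig_b, grig_c, grig_d}"
  shows "sections_simulate s"
proof -
  have "simulates_Grigorchuk s" if "s \<in> {id, grig_a, grig_b, grig_c, grig_d}" for s
    using that simulates_id simulates_grig by blast
  moreover have "tree_aut s" using assms tree_aut_id tree_aut_grig by blast
  ultimately show ?thesis using sect_grig[OF assms] unfolding sections_simulate_def by blast
qed


section \<open>The Grigorchuk group\<close>

lemma grig_a_Cons [simp]: "grig_a [] = []" "grig_a (x # w) = (x + 1) # w"
  by (simp_all add: grig_a_def)

lemma grig_a_involution [simp]: "grig_a (grig_a w) = w"
  by (cases w) (simp_all add: add.assoc)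

lemma grig_bcd_relations [simp]:
  "grig_b (grig_b w) = w" "grig_c (grig_c w) = w" "grig_d (grig_d w) = w"
  by (induction w and w and w rule: grig_b_grig_c_grig_d.induct) simp_all

lemma grig_involutions:
  "grig_a \<circ> grig_a = id" "grig_b \<circ> grig_b = id" "grig_c \<circ> grig_c = id" "grig_d \<circ> grig_d = id"
  by (simp_all add: fun_eq_iff)

lemma grig_d_c [simp]: "grig_d (grig_c w) = grig_b w"
proof -
  \<comment> \<open>The section at 1 of each of these products is the next one in the cycle, so the
    induction carries all three identities.\<close>
  have "grig_d (grig_c w) = grig_b w \<and> grig_b (grig_d w) = grig_c w \<and> grig_c (grig_b w) = grig_d w"
    by (induction w) auto
  then show ?thesis by simp
qed

lemma Grigorchuk_tree_aut: "g \<in> Grigorchuk \<Longrightarrow> tree_aut g"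
  using subgroup.mem_carrier[OF subgroup_Grigorchuk] by (simp add: AutT_def)

lemma Grigorchuk_comp: "g \<in> Grigorchuk \<Longrightarrow> h \<in> Grigorchuk \<Longrightarrow> h \<circ> g \<in> Grigorchuk"
  using subgroup.m_closed[OF subgroup_Grigorchuk, of g h] by (simp add: AutT_def)

lemma Grigorchuk_id: "id \<in> Grigorchuk"
  using subgroup.one_closed[OF subgroup_Grigorchuk] by (simp add: AutT_def)

lemma Grigorchuk_generators:
  "grig_a \<in> Grigorchuk" "grig_b \<in> Grigorchuk" "grig_c \<in> Grigorchuk" "grig_d \<in> Grigorchuk"
  unfolding Grigorchuk_def by (auto intro: generate.incl)

lemma Grigorchuk_inverse:
  assumes "h \<in> Grigorchuk"
  obtains h' where "h' \<in> Grigorchuk" "h' \<circ> h = id" "h \<circ> h' = id"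
proof
  have h: "h \<in> carrier AutT" using assms subgroup.mem_carrier[OF subgroup_Grigorchuk] by blast
  show "inv\<^bsub>AutT\<^esub> h \<in> Grigorchuk" by (rule subgroup.m_inv_closed[OF subgroup_Grigorchuk assms])
  show "inv\<^bsub>AutT\<^esub> h \<circ> h = id" "h \<circ> inv\<^bsub>AutT\<^esub> h = id"
    using group.r_inv[OF group_AutT h] group.l_inv[OF group_AutT h] by (simp_all add: AutT_def)
qed

lemma Grigorchuk_sections_simulate:
  assumes "g \<in> Grigorchuk"
  shows "sections_simulate g"
  using assms unfolding Grigorchuk_def
proof (induction rule: generate.induct)
  case one
  then show ?case using sections_simulate_grig[of id] by (simp add: AutT_def id_def)
next
  case (incl h)
  then show ?case using sections_simulate_grig by blast
next
  case (inv h)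
  have "h \<in> carrier AutT" using inv tree_aut_grig by (auto simp: AutT_def)
  moreover have "h \<otimes>\<^bsub>AutT\<^esub> h = \<one>\<^bsub>AutT\<^esub>" using inv by (auto simp: AutT_def fun_eq_iff)
  ultimately have "inv\<^bsub>AutT\<^esub> h = h" by (simp add: group.inv_equality[OF group_AutT])
  then show ?case using inv sections_simulate_grig by auto
next
  case (eng g h)
  then show ?case using sections_simulate_comp[of g h] by (simp add: AutT_def comp_def)
qed

section \<open>Making an automorphism trivial on level 3\<close>

lemma clear_level:
  assumes single: "\<And>v. length v = n \<Longrightarrow>
      \<exists>r\<in>Grigorchuk. agree_on_level r id n \<and> (\<forall>u. length u = n \<longrightarrow> activity r u = (if u = v then 1 else 0))"
    and g: "tree_aut g" "agree_on_level g id n"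
  shows "\<exists>h\<in>Grigorchuk. agree_on_level (h \<circ> g) id (Suc n)"
proof -
  \<comment> \<open>\<open>V\<close> holds the vertices of level \<open>n\<close> that are already
    cleared. All automorphisms involved fix level \<open>n\<close> pointwise, so activities there
    simply add, and composing with the element that is active only at \<open>v\<close> corrects
    \<open>v\<close> without disturbing the other vertices.\<close>
  let ?P = "\<lambda>V h. agree_on_level (h \<circ> g) id n \<and> (\<forall>u\<in>V. activity (h \<circ> g) u = 0)"
  have "\<exists>h\<in>Grigorchuk. ?P V h" if "finite V" "V \<subseteq> {u. length u = n}" for V
    using that
  proof (induction V rule: finite_induct)
    case empty
    then show ?case using Grigorchuk_id g(2) by (metis empty_iff comp_id id_comp)
  next
    case (insert v V)
    then obtain h where h: "h \<in> Grigorchuk" "?P V h" by blast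
    show ?case
    proof (cases "activity (h \<circ> g) v = 0")
      case True
      then show ?thesis using h by blast
    next
      case False
      then have act: "activity (h \<circ> g) v = 1" by simp
      obtain r where r: "r \<in> Grigorchuk" "agree_on_level r id n"
        "\<And>u. length u = n \<Longrightarrow> activity r u = (if u = v then 1 else 0)"
        using single[of v] insert.prems by auto
      have t: "tree_aut (h \<circ> g)" "tree_aut r"
        using tree_aut_comp[OF g(1)] Grigorchuk_tree_aut h r by auto
      have fix1: "(h \<circ> g) u = u" if "length u = n" for u
        using h that by (simp add: agree_on_level_def)
      have "activity (r \<circ> (h \<circ> g)) u = 0" if "u \<in> insert v V" for u
      proof -
        have u: "length u = n" using that insert.prems by auto
        show ?thesis
          using that h act r(3)[OF u] insert.hyps
          unfolding activity_comp[OF t] fix1[OF u] by auto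
      qed
      moreover have "agree_on_level (r \<circ> (h \<circ> g)) id n"
        using h r by (simp add: agree_on_level_def)
      ultimately show ?thesis
        using Grigorchuk_comp[OF h(1) r(1)] unfolding o_assoc by blast
    qed
  qed
  moreover have "finite {u :: word. length u = n}"
  proof -
    have "(UNIV :: bit set) = {0, 1}" using bit.exhaust by blast
    then have "finite (UNIV :: bit set)" by (metis finite.emptyI finite_insert)
    from finite_lists_length_eq[OF this, of n] show ?thesis by simp
  qed
  ultimately obtain h where "h \<in> Grigorchuk" "?P {u. length u = n} h" by blast
  then show ?thesis
    using tree_aut_comp[OF g(1)] Grigorchuk_tree_aut
    by (intro bexI[of _ h]) (auto simp: agree_on_level_iff_activity tree_aut_id less_Suc_eq simp del: o_apply)
qed

text \<open>Unfolds a statement about all words of a fixed length into a finite conjunction, so that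
  claims about concrete elements are proved by evaluation.\<close>

lemma all_words_of_length:
  "(\<forall>u :: word. length u = 0 \<longrightarrow> P u) \<longleftrightarrow> P []"
  "(\<forall>u :: word. length u = Suc n \<longrightarrow> P u) \<longleftrightarrow>
    (\<forall>u. length u = n \<longrightarrow> P (0 # u)) \<and> (\<forall>u. length u = n \<longrightarrow> P (1 # u))"
  by (auto simp: length_Suc_conv) (metis bit.exhaust)

lemma activity_at_single_vertex:
  "\<exists>r\<in>Grigorchuk. agree_on_level r id 1 \<and> (\<forall>u. length u = 1 \<longrightarrow> activity r u = (if u = [x] then 1 else 0))"
  "\<exists>r\<in>Grigorchuk. agree_on_level r id 2 \<and> (\<forall>u. length u = 2 \<longrightarrow> activity r u = (if u = [x, y] then 1 else 0))"
proof -
  let ?S = "\<lambda>r n v. agree_on_level r id n \<and>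
      (\<forall>u. length u = n \<longrightarrow> activity r u = (if u = v then 1 else 0))"
  \<comment> \<open>On level 1, b = (a,c) and aba = (c,a) are active at 0 and at 1 only. On level 2,
    d = (1,b) is active at 10 only; conjugation by a, by aba and by a followed by b moves this
    vertex to 00, 11 and 01.\<close>
  let ?aba = "grig_a \<circ> grig_b \<circ> grig_a" and ?ada = "grig_a \<circ> grig_d \<circ> grig_a"
  have G: "?aba \<in> Grigorchuk" "?ada \<in> Grigorchuk" "?aba \<circ> grig_d \<circ> ?aba \<in> Grigorchuk"
    "grig_b \<circ> ?ada \<circ> grig_b \<in> Grigorchuk"
    by (intro Grigorchuk_comp Grigorchuk_generators)+
  note eval = agree_on_level_def activity_last numeral_2_eq_2 all_words_of_length One_nat_def
  have "?S grig_b 1 [0]" "?S ?aba 1 [1]"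
    unfolding eval activity_last[OF Grigorchuk_tree_aut[OF G(1)]] activity_last[OF tree_aut_grig(2)]
    by simp_all
  then show "\<exists>r\<in>Grigorchuk. ?S r 1 [x]" using G(1) Grigorchuk_generators by (cases x) blast+
  have "?S grig_d 2 [1, 0]" "?S ?ada 2 [0, 0]" "?S (?aba \<circ> grig_d \<circ> ?aba) 2 [1, 1]"
    "?S (grig_b \<circ> ?ada \<circ> grig_b) 2 [0, 1]"
    unfolding eval activity_last[OF tree_aut_grig(4)]
      G(2-4)[THEN Grigorchuk_tree_aut, THEN activity_last]
    by simp_all
  then show "\<exists>r\<in>Grigorchuk. ?S r 2 [x, y]"
    using G(2-4) Grigorchuk_generators by (cases x; cases y) blast+
qed

text \<open>Levels 0, 1 and 2 are cleared in turn. Level 3 does not yield to the same method: an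
  element of the group that is trivial on level 3 simulates, so it cannot be active at exactly one
  vertex of that level.\<close>

lemma clear_three_levels:
  assumes g: "tree_aut g"
  shows "\<exists>h\<in>Grigorchuk. agree_on_level (h \<circ> g) id 3"
proof -
  let ?single = "\<lambda>n v. \<exists>r\<in>Grigorchuk. agree_on_level r id n \<and>
      (\<forall>u. length u = n \<longrightarrow> activity r u = (if u = v then 1 else 0))"
  have step: "\<exists>h\<in>Grigorchuk. agree_on_level (h \<circ> g) id (Suc n)"
    if single: "\<And>v. length v = n \<Longrightarrow> ?single n v"
    and h: "\<exists>h\<in>Grigorchuk. agree_on_level (h \<circ> g) id n" for n
  proof -
    obtain h where h: "h \<in> Grigorchuk" "agree_on_level (h \<circ> g) id n" using h by blast
    obtain k where "k \<in> Grigorchuk" "agree_on_level (k \<circ> (h \<circ> g)) id (Suc n)"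
      using clear_level[OF single _ h(2)] tree_aut_comp[OF g Grigorchuk_tree_aut[OF h(1)]] by auto
    then show ?thesis using Grigorchuk_comp[OF h(1)] by (metis o_assoc)
  qed
  have s0: "?single 0 v" if "length v = 0" for v
    using that Grigorchuk_generators tree_aut_grig
    by (intro bexI[of _ grig_a]) (simp_all add: agree_on_level_def activity_grig_a)
  have s1: "?single 1 v" if v: "length v = 1" for v
  proof -
    obtain x where "v = [x]" using v by (cases v) auto
    then show ?thesis using activity_at_single_vertex(1) by simp
  qed
  have s2: "?single 2 v" if v: "length v = 2" for v
  proof -
    obtain x y where "v = [x, y]" using v by (auto simp: length_Suc_conv numeral_2_eq_2)
    then show ?thesis using activity_at_single_vertex(2) by simp
  qed
  have "\<exists>h\<in>Grigorchuk. agree_on_level (h \<circ> g) id 0"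
    using g Grigorchuk_id by (intro bexI[of _ id]) (simp_all add: agree_on_level_def tree_aut_def)
  then have "\<exists>h\<in>Grigorchuk. agree_on_level (h \<circ> g) id 1"
    using step[OF s0] by simp
  then have "\<exists>h\<in>Grigorchuk. agree_on_level (h \<circ> g) id 2"
    using step[OF s1] by (simp add: numeral_2_eq_2)
  then show ?thesis
    using step[OF s2] by (simp add: numeral_3_eq_3 numeral_2_eq_2)
qed


section \<open>The branching subgroup\<close>

lemma wreath_comp: "wreath h0 h1 0 \<circ> wreath g0 g1 0 = wreath (h0 \<circ> g0) (h1 \<circ> g1) 0"
proof
  show "(wreath h0 h1 0 \<circ> wreath g0 g1 0) w = wreath (h0 \<circ> g0) (h1 \<circ> g1) 0 w" for w
    by (cases w) simp_all
qed

lemma wreath_id: "wreath id id 0 = id"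
proof
  show "wreath id id 0 w = id w" for w by (cases w) simp_all
qed

lemma agree_on_level_wreath:
  assumes "agree_on_level g0 h0 n" "agree_on_level g1 h1 n"
  shows "agree_on_level (wreath g0 g1 e) (wreath h0 h1 e) (Suc n)"
  using assms by (auto simp: agree_on_level_def length_Suc_conv)

text \<open>These formulas lift conjugation of one coordinate by a generator to conjugation of the
  pair by a generator. If the other coordinate is \<open>id\<close>, it stays
  \<open>id\<close>.\<close>

lemma wreath_conj:
  "grig_a \<circ> wreath g0 g1 0 \<circ> grig_a = wreath g1 g0 0"
  "grig_b \<circ> wreath g0 g1 0 \<circ> grig_b = wreath (grig_a \<circ> g0 \<circ> grig_a) (grig_c \<circ> g1 \<circ> grig_c) 0"
  "grig_c \<circ> wreath g0 g1 0 \<circ> grig_c = wreath (grig_a \<circ> g0 \<circ> grig_a) (grig_d \<circ> g1 \<circ> grig_d) 0"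
  "grig_d \<circ> wreath g0 g1 0 \<circ> grig_d = wreath g0 (grig_b \<circ> g1 \<circ> grig_b) 0"
proof -
  show "grig_a \<circ> wreath g0 g1 0 \<circ> grig_a = wreath g1 g0 0"
  proof
    show "(grig_a \<circ> wreath g0 g1 0 \<circ> grig_a) w = wreath g1 g0 0 w" for w
    proof (cases w)
      case (Cons x v)
      then show ?thesis by (cases x) simp_all
    qed simp
  qed
qed (subst (1 2) grig_wreath, simp only: wreath_comp id_comp comp_id)+

text \<open>This is the normal closure of \<open>(ab)\<^sup>2\<close>: the generators are involutions, and the inverse of
  \<open>(ab)\<^sup>2\<close> is its conjugate by \<open>b\<close>.\<close>

inductive_set branch_K :: "(word \<Rightarrow> word) set" where
  one: "id \<in> branch_K"
| base: "grig_b \<circ> grig_a \<circ> grig_b \<circ> grig_a \<in> branch_K"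
| conj: "k \<in> branch_K \<Longrightarrow> s \<in> {grig_a, grig_b, grig_c, grig_d} \<Longrightarrow> s \<circ> k \<circ> s \<in> branch_K"
| mult: "k \<in> branch_K \<Longrightarrow> l \<in> branch_K \<Longrightarrow> l \<circ> k \<in> branch_K"

lemma branch_K_Grigorchuk: "k \<in> branch_K \<Longrightarrow> k \<in> Grigorchuk"
proof (induction rule: branch_K.induct)
  case (conj k s)
  then show ?case using Grigorchuk_comp Grigorchuk_generators by blast
qed (intro Grigorchuk_id Grigorchuk_comp Grigorchuk_generators; assumption)+

text \<open>Products and conjugates lift because the second coordinate stays trivial; the case with
  content is the generator of the normal closure.\<close>

lemma wreath_branch_K_left: "k \<in> branch_K \<Longrightarrow> wreath k id 0 \<in> branch_K"
proof (induction rule: branch_K.induct)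
  case one
  then show ?case using branch_K.one wreath_id by metis
next
  case base
  let ?k = "grig_b \<circ> grig_a \<circ> grig_b \<circ> grig_a"
  \<comment> \<open>Both sides are \<open>(bada)\<^sup>2 = (ab, c)\<^sup>2\<close>.\<close>
  have "wreath ?k id 0 = (grig_a \<circ> (grig_c \<circ> ?k \<circ> grig_c) \<circ> grig_a) \<circ> (grig_b \<circ> ?k \<circ> grig_b)"
  proof
    show "wreath ?k id 0 w = ((grig_a \<circ> (grig_c \<circ> ?k \<circ> grig_c) \<circ> grig_a) \<circ> (grig_b \<circ> ?k \<circ> grig_b)) w" for w
    proof (cases w)
      case (Cons x v)
      then show ?thesis by (cases x) simp_all
    qed simp
  qed
  also have "\<dots> \<in> branch_K" by (intro branch_K.mult branch_K.conj branch_K.base) auto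
  finally show ?case .
next
  case (conj k s)
  \<comment> \<open>Conjugation by a is available on the left coordinate, through b. For b, c, d the
    element is moved to the right coordinate by a, conjugated there through d, b, c respectively,
    and moved back.\<close>
  have "wreath (grig_a \<circ> k \<circ> grig_a) id 0 = grig_b \<circ> wreath k id 0 \<circ> grig_b"
    "wreath (grig_b \<circ> k \<circ> grig_b) id 0 = grig_a \<circ> (grig_d \<circ> (grig_a \<circ> wreath k id 0 \<circ> grig_a) \<circ> grig_d) \<circ> grig_a"
    "wreath (grig_c \<circ> k \<circ> grig_c) id 0 = grig_a \<circ> (grig_b \<circ> (grig_a \<circ> wreath k id 0 \<circ> grig_a) \<circ> grig_b) \<circ> grig_a"
    "wreath (grig_d \<circ> k \<circ> grig_d) id 0 = grig_a \<circ> (grig_c \<circ> (grig_a \<circ> wreath k id 0 \<circ> grig_a) \<circ> grig_c) \<circ> grig_a"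
    by (simp_all only: wreath_conj comp_id grig_involutions)
  moreover have "s' \<circ> wreath k id 0 \<circ> s' \<in> branch_K"
    "grig_a \<circ> (s' \<circ> (grig_a \<circ> wreath k id 0 \<circ> grig_a) \<circ> s') \<circ> grig_a \<in> branch_K"
    if "s' \<in> {grig_a, grig_b, grig_c, grig_d}" for s'
    using that by (intro branch_K.conj conj.IH; blast)+
  ultimately show ?case using conj.hyps(2) by (metis insert_iff empty_iff)
next
  case (mult k l)
  have "wreath (l \<circ> k) id 0 = wreath l id 0 \<circ> wreath k id 0" by (simp add: wreath_comp)
  then show ?case using branch_K.mult[OF mult.IH] by (simp only:)
qed

lemma wreath_branch_K:
  assumes "k \<in> branch_K" "l \<in> branch_K"
  shows "wreath k l 0 \<in> branch_K"
proof -
  have "wreath k l 0 = (grig_a \<circ> wreath l id 0 \<circ> grig_a) \<circ> wreath k id 0"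
    by (simp only: wreath_conj wreath_comp id_comp comp_id)
  also have "\<dots> \<in> branch_K"
    using assms by (intro branch_K.mult branch_K.conj wreath_branch_K_left) auto
  finally show ?thesis .
qed

lemma tree_aut_branch_K: "k \<in> branch_K \<Longrightarrow> tree_aut k"
  by (rule Grigorchuk_tree_aut[OF branch_K_Grigorchuk])

section \<open>Approximation one level at a time\<close>

lemma branch_K_level_3:
  assumes g: "sections_simulate g" "agree_on_level g id 3"
  shows "\<exists>k\<in>branch_K. agree_on_level g k 4"
proof -
  have t: "tree_aut g" using g(1) by (simp add: sections_simulate_def)
  have low: "activity g u = 0" if "length u < 3" for u
    using g(2) that by (simp add: agree_on_level_iff_activity[OF t tree_aut_id])
  define s where "s x y z = activity g [x, y, z]" for x y z
  \<comment> \<open>The activities above level 3 vanish, so each decoration is the sum of the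
    activities at the two children of one vertex of level 2. Simulation makes the four sums equal;
    \<open>e\<close> is their common value.\<close>
  define e where "e = s 0 0 0 + s 0 0 1"
  have "simulates_Grigorchuk g"
    using g(1) sect_simps(1) unfolding sections_simulate_def by metis
  then have "beta g x y = beta g 0 1" for x y
    using low[of "[0]"] low[of "[1]"] by (cases x; cases y) (simp_all add: simulates_iff)
  moreover have "beta g x (y + 1) = s x y 0 + s x y 1" for x y
    using low[of "[x, y + 1]"] by (simp add: beta_def s_def add.assoc)
  ultimately have "s x y 0 + s x y 1 = e" for x y
    unfolding e_def by metis
  then have "s x y 1 = s x y 0 + e" for x y
    by (metis bit_add_self(2))
  then have s: "s x y z = s x y 0 + e * z" for x y z
    by (cases z) simp_all
  define \<kappa> where "\<kappa> = grig_b \<circ> grig_a \<circ> grig_b \<circ> grig_a"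
  have \<kappa>: "\<kappa> \<in> branch_K" unfolding \<kappa>_def by (rule branch_K.base)
  \<comment> \<open>\<open>\<kappa>\<close> is inactive at the root and active at both vertices of
    level 1, so \<open>P t\<close> puts the activity \<open>t\<close> at both.\<close>
  define P where "P t = (if t = 1 then \<kappa> else id)" for t :: bit
  have P: "P t \<in> branch_K" "agree_on_level (P t) id 1" "activity (P t) [z] = t" for t z
  proof -
    show K: "P t \<in> branch_K" using \<kappa> branch_K.one by (simp add: P_def)
    show "agree_on_level (P t) id 1"
      by (simp add: P_def \<kappa>_def agree_on_level_def all_words_of_length)
    show "activity (P t) [z] = t"
      unfolding activity_last[OF tree_aut_branch_K[OF K]]
      by (cases t; cases z) (simp_all add: P_def \<kappa>_def)
  qed
  \<comment> \<open>A copy of \<open>P\<close> at each vertex of level 2 prescribes one common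
    activity for its two children. The summand \<open>e\<close> anticipates the factor
    \<open>k1\<close> below, which contributes \<open>e\<close> at the child 0 and nothing at the
    child 1.\<close>
  define k0 where "k0 = wreath (wreath (P (s 0 0 0 + e)) (P (s 0 1 0 + e)) 0)
    (wreath (P (s 1 0 0 + e)) (P (s 1 1 0 + e)) 0) 0"
  have k0: "k0 \<in> branch_K" unfolding k0_def by (intro wreath_branch_K P)
  have k0_act: "activity k0 [x, y, z] = s x y 0 + e" for x y z
    unfolding k0_def by (cases x; cases y) (simp_all add: activity_wreath P)
  have "agree_on_level k0 (wreath (wreath id id 0) (wreath id id 0) 0) (Suc (Suc 1))"
    unfolding k0_def by (intro agree_on_level_wreath P)
  then have k0_id: "agree_on_level k0 id (Suc (Suc 1))" unfolding wreath_id .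
  \<comment> \<open>\<open>(ab)\<^sup>2\<close> placed at \<open>xy\<close> changes \<open>\<alpha>\<^bsub>xy0\<^esub>\<close> and \<open>\<alpha>\<^bsub>xy1\<^esub>\<close> simultaneously, so one more element is needed
    for \<open>e = 1\<close>: this product of two conjugates of \<open>(ab)\<^sup>2\<close> is active exactly at the vertices \<open>xy0\<close> of level 3.\<close>
  define k1 where "k1 = (if e = 1 then
    (grig_c \<circ> (grig_a \<circ> (grig_d \<circ> \<kappa> \<circ> grig_d) \<circ> grig_a) \<circ> grig_c) \<circ> \<kappa> else id)"
  have k1: "k1 \<in> branch_K"
    unfolding k1_def by (auto intro!: branch_K.mult branch_K.conj \<kappa> branch_K.one simp del: o_apply)
  have k1_id: "agree_on_level k1 id 3"
    by (simp add: k1_def \<kappa>_def agree_on_level_def all_words_of_length numeral_3_eq_3)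
  have k1_act: "activity k1 [x, y, z] = e * (z + 1)" for x y z
    unfolding activity_last[OF tree_aut_branch_K[OF k1]]
    by (cases e; cases x; cases y; cases z) (simp_all add: k1_def \<kappa>_def)
  have k: "k1 \<circ> k0 \<in> branch_K" using k0 k1 by (intro branch_K.mult)
  have k_id: "agree_on_level (k1 \<circ> k0) id 3"
    using k0_id k1_id by (simp add: agree_on_level_def numeral_3_eq_3)
  have "activity g u = activity (k1 \<circ> k0) u" if "length u < 4" for u
  proof (cases "length u = 3")
    case True
    then obtain x y z where u: "u = [x, y, z]" by (auto simp: numeral_3_eq_3 length_Suc_conv)
    \<comment> \<open>Since \<open>k0\<close> fixes level 3, the activities of the two factors add
      at the same vertex.\<close>
    have "k0 u = u" using k0_id True by (simp add: agree_on_level_def numeral_3_eq_3)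
    then have "activity (k1 \<circ> k0) u = s x y 0 + e + e * (z + 1)"
      using k0 k0_act k1_act k1 by (simp add: activity_comp tree_aut_branch_K u)
    also have "\<dots> = s x y 0 + e * z" by (simp add: algebra_simps)
    finally show ?thesis unfolding s[of x y z, symmetric] by (simp add: s_def u)
  next
    case False
    then have "length u < 3" using that by simp
    then show ?thesis
      using k_id low by (simp add: agree_on_level_iff_activity[OF tree_aut_branch_K[OF k] tree_aut_id])
  qed
  then have "agree_on_level g (k1 \<circ> k0) 4"
    by (simp add: agree_on_level_iff_activity[OF t tree_aut_branch_K[OF k]])
  then show ?thesis using k by blast
qed

text \<open>The induction descends to the sections at 0 and 1, which are trivial to one level less.
  This is why the hypothesis concerns all sections of \<open>g\<close> and why \<open>g\<close> is
  generalised.\<close>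

lemma branch_K_approximates:
  assumes "n \<ge> 3" "sections_simulate g" "agree_on_level g id n"
  shows "\<exists>k\<in>branch_K. agree_on_level g k (Suc n)"
  using assms
proof (induction n arbitrary: g rule: nat_induct_at_least)
  case base
  moreover have "Suc 3 = 4" by simp
  ultimately show ?case using branch_K_level_3 by metis
next
  case (Suc n)
  have t: "tree_aut g" using Suc.prems(1) by (simp add: sections_simulate_def)
  have act: "activity g u = 0" if "length u < Suc n" for u
    using Suc.prems(2) that unfolding agree_on_level_iff_activity[OF t tree_aut_id] by simp
  have "\<exists>k\<in>branch_K. agree_on_level (letter_section g x) k (Suc n)" for x
  proof (rule Suc.IH)
    show "sections_simulate (letter_section g x)"
      using Suc.prems(1) by (rule sections_simulate_letter_section)
    have "activity (letter_section g x) u = 0" if "length u < n" for u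
      using that act[of "x # u"] activity_sect[of g "[x]" u] by (simp add: sect_def)
    then show "agree_on_level (letter_section g x) id n"
      by (simp add: agree_on_level_iff_activity tree_aut_letter_section[OF t] tree_aut_id)
  qed
  then obtain k0 k1 where k: "k0 \<in> branch_K" "agree_on_level (letter_section g 0) k0 (Suc n)"
    "k1 \<in> branch_K" "agree_on_level (letter_section g 1) k1 (Suc n)"
    by meson
  have "g = wreath (letter_section g 0) (letter_section g 1) 0"
    using tree_aut_eq_wreath[OF t] act[of "[]"] by simp
  then have "agree_on_level g (wreath k0 k1 0) (Suc (Suc n))"
    using agree_on_level_wreath[OF k(2,4)] by metis
  then show ?case using wreath_branch_K k by blast
qed

text \<open>If \<open>h\<close> agrees with \<open>g\<close> on level \<open>m\<close>, then
  \<open>h' \<circ> g\<close>, with \<open>h'\<close> the inverse of \<open>h\<close>, is trivial on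
  that level, and its sections still simulate because those of group elements do. An element
  \<open>k\<close> of \<open>branch_K\<close> matches it one level further, and
  \<open>h \<circ> k\<close> is the improved approximation of \<open>g\<close>.\<close>

lemma Grigorchuk_approximates:
  assumes g: "sections_simulate g"
  shows "\<exists>h\<in>Grigorchuk. agree_on_level g h n"
proof -
  have t: "tree_aut g" using g by (simp add: sections_simulate_def)
  have "\<exists>h\<in>Grigorchuk. agree_on_level g h m" if "m \<ge> 3" for m
    using that
  proof (induction m rule: nat_induct_at_least)
    case base
    obtain h where h: "h \<in> Grigorchuk" "agree_on_level (h \<circ> g) id 3"
      using clear_three_levels[OF t] by blast
    obtain h' where h': "h' \<in> Grigorchuk" "h' \<circ> h = id"
      using Grigorchuk_inverse[OF h(1)] by metis
    have "agree_on_level (h' \<circ> (h \<circ> g)) (h' \<circ> id) 3" using h(2) by (rule agree_on_level_comp_left)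
    then have "agree_on_level g h' 3" by (simp only: o_assoc h'(2) id_comp comp_id)
    then show ?case using h' by blast
  next
    case (Suc m)
    then obtain h where h: "h \<in> Grigorchuk" "agree_on_level g h m" by blast
    obtain h' where h': "h' \<in> Grigorchuk" "h' \<circ> h = id" "h \<circ> h' = id"
      using Grigorchuk_inverse[OF h(1)] by metis
    have "sections_simulate (h' \<circ> g)"
      using g Grigorchuk_sections_simulate[OF h'(1)] by (rule sections_simulate_comp)
    moreover have "agree_on_level (h' \<circ> g) id m"
      using agree_on_level_comp_left[OF h(2), of h'] by (simp only: h'(2))
    ultimately obtain k where k: "k \<in> branch_K" "agree_on_level (h' \<circ> g) k (Suc m)"
      using branch_K_approximates Suc.hyps by blast
    have "agree_on_level (h \<circ> (h' \<circ> g)) (h \<circ> k) (Suc m)" using k(2) by (rule agree_on_level_comp_left)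
    then have "agree_on_level g (h \<circ> k) (Suc m)" by (simp only: o_assoc h'(3) id_comp)
    then show ?case using Grigorchuk_comp[OF branch_K_Grigorchuk[OF k(1)] h(1)] by blast
  qed
  \<comment> \<open>The induction starts at 3; agreement on a deeper level covers the smaller
    \<open>n\<close>.\<close>
  then obtain h where h: "h \<in> Grigorchuk" "agree_on_level g h (max n 3)" by (meson max.cobounded2)
  then show ?thesis
    using agree_on_level_mono[OF t Grigorchuk_tree_aut[OF h(1)] h(2), of n] by auto
qed


section \<open>Distances\<close>

lemma aut_dist_le_iff:
  assumes "tree_aut g" "tree_aut h"
  shows "aut_dist g h \<le> 1 / 2 ^ n \<longleftrightarrow> agree_on_level g h n"
proof (cases "g = h")
  case False
  then show ?thesis
    using agree_on_level_Greatest[OF assms, of n] by (simp add: aut_dist_def field_simps)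
qed (simp add: aut_dist_def agree_on_level_def)

text \<open>Nonzero distances are powers of 1/2, so a strict bound gains one level.\<close>

lemma aut_dist_less_iff:
  assumes "tree_aut g" "tree_aut h"
  shows "aut_dist g h < 1 / 2 ^ n \<longleftrightarrow> agree_on_level g h (Suc n)"
proof (cases "g = h")
  case False
  then show ?thesis
    using agree_on_level_Greatest[OF assms, of "Suc n"] by (simp add: aut_dist_def field_simps Suc_le_eq)
qed (simp add: aut_dist_def agree_on_level_def)

text \<open>A bound on the infimum does not directly give an element attaining it. However, an
  infimum strictly below \<open>1 / 2 ^ n\<close> gives an element at distance below
  \<open>1 / 2 ^ n\<close>, and by discreteness this element already agrees on level
  \<open>Suc n\<close>.\<close>

lemma dist_to_Grigorchuk_le_iff:
  assumes "tree_aut g"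
  shows "dist_to_Grigorchuk g \<le> 1 / 2 ^ Suc n \<longleftrightarrow> (\<exists>h\<in>Grigorchuk. agree_on_level g h (Suc n))"
proof
  have bdd: "bdd_below (aut_dist g ` Grigorchuk)"
    by (rule bdd_belowI[of _ 0]) (auto simp: aut_dist_def)
  assume "dist_to_Grigorchuk g \<le> 1 / 2 ^ Suc n"
  also have "\<dots> < (1 / 2 ^ n :: real)" by (simp add: field_simps)
  finally obtain h where "h \<in> Grigorchuk" "aut_dist g h < 1 / 2 ^ n"
    using Grigorchuk_id cINF_less_iff[OF _ bdd] unfolding dist_to_Grigorchuk_def by blast
  then show "\<exists>h\<in>Grigorchuk. agree_on_level g h (Suc n)"
    using aut_dist_less_iff[OF assms Grigorchuk_tree_aut] by blast
next
  have bdd: "bdd_below (aut_dist g ` Grigorchuk)"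
    by (rule bdd_belowI[of _ 0]) (auto simp: aut_dist_def)
  assume "\<exists>h\<in>Grigorchuk. agree_on_level g h (Suc n)"
  then obtain h where h: "h \<in> Grigorchuk" "aut_dist g h \<le> 1 / 2 ^ Suc n"
    using aut_dist_le_iff[OF assms Grigorchuk_tree_aut] by blast
  show "dist_to_Grigorchuk g \<le> 1 / 2 ^ Suc n"
    unfolding dist_to_Grigorchuk_def by (rule order_trans[OF cINF_lower[OF bdd h(1)] h(2)])
qed

lemma closure_Grigorchuk_iff:
  assumes "tree_aut g"
  shows "g \<in> AutT_topology closure_of Grigorchuk \<longleftrightarrow> (\<forall>n. \<exists>h\<in>Grigorchuk. agree_on_level g h n)"
proof -
  interpret Metric_space "carrier AutT" aut_dist by (rule Metric_space_AutT)
  have carrier: "f \<in> carrier AutT \<longleftrightarrow> tree_aut f" for f by (simp add: AutT_def)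
  have "g \<in> AutT_topology closure_of Grigorchuk \<longleftrightarrow> (\<forall>r>0. \<exists>h\<in>Grigorchuk. aut_dist g h \<le> r)"
    unfolding AutT_topology_def metric_closure_of_alt in_mcball
    using assms Grigorchuk_tree_aut by (auto simp: carrier)
  also have "\<dots> \<longleftrightarrow> (\<forall>n. \<exists>h\<in>Grigorchuk. aut_dist g h \<le> 1 / 2 ^ n)"
  proof (intro iffI allI impI)
    fix n assume "\<forall>r>0. \<exists>h\<in>Grigorchuk. aut_dist g h \<le> r"
    then show "\<exists>h\<in>Grigorchuk. aut_dist g h \<le> 1 / 2 ^ n" by simp
  next
    fix r :: real assume a: "\<forall>n. \<exists>h\<in>Grigorchuk. aut_dist g h \<le> 1 / 2 ^ n" and "r > 0"
    then obtain n where "(1 / 2) ^ n < r" using real_arch_pow_inv[of r "1 / 2"] by auto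
    then have "1 / 2 ^ n \<le> r" by (simp add: power_one_over)
    then show "\<exists>h\<in>Grigorchuk. aut_dist g h \<le> r" using a order_trans by blast
  qed
  also have "\<dots> \<longleftrightarrow> (\<forall>n. \<exists>h\<in>Grigorchuk. agree_on_level g h n)"
    using aut_dist_le_iff[OF assms Grigorchuk_tree_aut] by blast
  finally show ?thesis .
qed

text \<open>Simulation involves activities at vertices of length at most 3, and the action on level
  4 determines these. This is the origin of the bound 1/16.\<close>

lemma simulates_cong:
  assumes "tree_aut g" "tree_aut h" "agree_on_level g h 4" "simulates_Grigorchuk h"
  shows "simulates_Grigorchuk g"
proof -
  have "activity g u = activity h u" if "length u < 4" for u
    using assms(3) that by (simp add: agree_on_level_iff_activity[OF assms(1,2)])
  then have eq: "beta g x y = beta h x y" "activity g [x] = activity h [x]" for x y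
    by (simp_all add: beta_def)
  show ?thesis
    using assms(4) unfolding simulates_Grigorchuk_def eq .
qed

theorem theorem2:
  fixes g :: "word \<Rightarrow> word"
  assumes "g \<in> carrier AutT"
  shows "(g \<in> AutT_topology closure_of Grigorchuk \<longleftrightarrow> (\<forall>u. simulates_Grigorchuk (sect g u)))
       \<and> ((\<forall>u. simulates_Grigorchuk (sect g u)) \<longleftrightarrow> (\<forall>u. dist_to_Grigorchuk (sect g u) \<le> 1 / 16))"
proof -
  have g: "tree_aut g" using assms by (simp add: AutT_def)
  have s: "tree_aut (sect g u)" for u using g by (rule tree_aut_sect)
  have dist: "dist_to_Grigorchuk (sect g u) \<le> 1 / 16 \<longleftrightarrow> (\<exists>h\<in>Grigorchuk. agree_on_level (sect g u) h 4)" for u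
    using dist_to_Grigorchuk_le_iff[OF s, of u 3] by simp
  have G: "simulates_Grigorchuk (sect h u)" if "h \<in> Grigorchuk" for h u
    using Grigorchuk_sections_simulate[OF that] by (simp add: sections_simulate_def)
  have "simulates_Grigorchuk (sect g u)" if cl: "g \<in> AutT_topology closure_of Grigorchuk" for u
  proof -
    \<comment> \<open>Agreement to this depth leaves four levels of agreement for the sections at
      \<open>u\<close>.\<close>
    obtain h where h: "h \<in> Grigorchuk" "agree_on_level g h (length u + 4)"
      using cl closure_Grigorchuk_iff[OF g] by blast
    note t = Grigorchuk_tree_aut[OF h(1)]
    show ?thesis
      using simulates_cong[OF s tree_aut_sect[OF t] agree_on_level_sect[OF g t h(2)] G[OF h(1)]] .
  qed
  moreover have "g \<in> AutT_topology closure_of Grigorchuk"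
    "\<forall>u. dist_to_Grigorchuk (sect g u) \<le> 1 / 16"
    if "\<forall>u. simulates_Grigorchuk (sect g u)"
  proof -
    have F: "sections_simulate g" using that g by (simp add: sections_simulate_def)
    show "g \<in> AutT_topology closure_of Grigorchuk"
      using Grigorchuk_approximates[OF F] closure_Grigorchuk_iff[OF g] by blast
    show "\<forall>u. dist_to_Grigorchuk (sect g u) \<le> 1 / 16"
      using Grigorchuk_approximates[OF sections_simulate_sect[OF F]] dist by blast
  qed
  moreover have "simulates_Grigorchuk (sect g u)"
    if le: "\<forall>u. dist_to_Grigorchuk (sect g u) \<le> 1 / 16" for u
  proof -
    obtain h where h: "h \<in> Grigorchuk" "agree_on_level (sect g u) h 4"
      using le dist by blast
    show ?thesis
      using simulates_cong[OF s Grigorchuk_tree_aut[OF h(1)] h(2)] G[OF h(1), of "[]"]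
      by (simp add: sect_simps)
  qed
  ultimately show ?thesis by blast
qed

end
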